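(* For every integer $m\ge1$ and each problem $\mathcal{P}\in\{Qm(NP),Qm(PP),Qm(FP),Rm(NP),Rm(PP),Rm(FP)\}$, with the machine speeds (for $Q$) or processing times (for $R$) part of the input, $\frac{\sqrt{m}+1}{2}\le WAR(\mathcal{P})\le\sqrt{m}$.
   Context: Machines $M_1,\dots,M_m$, jobs $J_1,\dots,J_n$. Related machines ($Q$): machine $M_i$ has speed $s_i>0$, job $J_j$ has standard processing time $p_j>0$, and processing $J_j$ entirely on $M_i$ takes time $p_j/s_i$. Unrelated machines ($R$): processing $J_j$ entirely on $M_i$ takes time $p_{ij}>0$ (arbitrary). Schedules start at time $0$ and each machine processes at most one job at any time. $NP$: each job is processed without interruption on a single machine; $PP$: jobs may be interrupted and resumed, possibly on another machine, but each job is on at most one machine at any time; $FP$: each job may be split into parts processed on different machines, even concurrently. For a feasible schedule $S$, the load $L^S_i$ of $M_i$ is the time by which $M_i$ finishes all processing assigned to it, $L(S)=(L^S_1,\dots,L^S_m)$. For $X\in\mathbb{R}^m$ let $\overleftarrow{X}$ be $X$ sorted in non-increasing order and $\sigma(X)$ its prefix-sum vector; $X\preceq_s Y$ means $\sigma(\overleftarrow{X})\le\sigma(\overleftarrow{Y})$ coordinatewise. For an instance $\mathcal{I}$ with feasible schedules $\mathcal{S}$ and $S\in\mathcal{S}$, $s(S)$ is the infimum of $\alpha$ with $L(S)\preceq_s\alpha L(T)$ for all $T\in\mathcal{S}$, $s^*(\mathcal{I})=\inf_{S\in\mathcal{S}}s(S)$, and $WAR(\mathcal{P})=\sup_{\mathcal{I}}s^*(\mathcal{I})$,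 the supremum over all instances (all machine data and job sets) with $m$ fixed. *)

theory Defs
  imports Complex_Main "HOL-Library.Extended_Real"
begin

text \<open>
  Machines are indexed by \<open>i < m\<close> and jobs by \<open>j < n\<close>. Vectors in \<open>\<real>\<^sup>m\<close> are lists of length \<open>m\<close>.
\<close>

definition prefix_sums :: "real list \<Rightarrow> real list" where
  "prefix_sums xs = map (\<lambda>k. sum_list (take (Suc k) xs)) [0..<length xs]"

definition sort_desc :: "real list \<Rightarrow> real list" where
  "sort_desc xs = rev (sort xs)"

definition weak_maj :: "real list \<Rightarrow> real list \<Rightarrow> bool" (infix "\<preceq>\<^sub>s" 50) where
  "xs \<preceq>\<^sub>s ys \<longleftrightarrow>
     list_all2 (\<le>) (prefix_sums (sort_desc xs)) (prefix_sums (sort_desc ys))"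

datatype environment = Related | Unrelated

datatype preemption_mode = NP | PP | FP

text \<open>
  A piece records that its machine works on its job, without interruption, during the half-open
  time interval from \<open>start\<close> to \<open>finish\<close>; a schedule is a finite set of pieces.
\<close>

datatype piece = Piece (mach: nat) (job: nat) (start: real) (finish: real)

definition interval :: "piece \<Rightarrow> real set" where
  "interval x = {start x..<finish x}"

text \<open>
  An instance is a pair \<open>(n, t)\<close>, where \<open>t i j\<close> is the time that machine \<open>i\<close> needs to process
  job \<open>j\<close> entirely. Processing job \<open>j\<close> on machine \<open>i\<close> for time \<open>\<ell>\<close> thus completes the fraction
  \<open>\<ell> / t i j\<close> of the job.
\<close>

type_synonym inst = "nat \<times> (nat \<Rightarrow> nat \<Rightarrow> real)"

fun instances :: "environment \<Rightarrow> nat \<Rightarrow> inst set" where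
  "instances Related m =
     {(n, \<lambda>i j. p j / s i) | n s p. n \<ge> 1 \<and> (\<forall>i<m. s i > 0) \<and> (\<forall>j<n. p j > 0)}"
| "instances Unrelated m =
     {(n, t) | n t. n \<ge> 1 \<and> (\<forall>i<m. \<forall>j<n. t i j > 0)}"

definition processes_jobs :: "nat \<Rightarrow> inst \<Rightarrow> piece set \<Rightarrow> bool" where
  "processes_jobs m I S \<longleftrightarrow> (case I of (n, t) \<Rightarrow>
     finite S \<and>
     (\<forall>x\<in>S. mach x < m \<and> job x < n \<and> 0 \<le> start x \<and> start x < finish x) \<and>
     (\<forall>x\<in>S. \<forall>y\<in>S. x \<noteq> y \<and> mach x = mach y \<longrightarrow> interval x \<inter> interval y = {}) \<and>
     (\<forall>j<n. (\<Sum>x\<in>{x \<in> S. job x = j}. (finish x - start x) / t (mach x) j) = 1))"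

fun mode_ok :: "preemption_mode \<Rightarrow> nat \<Rightarrow> piece set \<Rightarrow> bool" where
  "mode_ok NP n S \<longleftrightarrow> (\<forall>j<n. \<exists>!x. x \<in> S \<and> job x = j)"
| "mode_ok PP n S \<longleftrightarrow>
     (\<forall>x\<in>S. \<forall>y\<in>S. x \<noteq> y \<and> job x = job y \<longrightarrow> interval x \<inter> interval y = {})"
| "mode_ok FP n S \<longleftrightarrow> True"

definition schedules :: "preemption_mode \<Rightarrow> nat \<Rightarrow> inst \<Rightarrow> piece set set" where
  "schedules M m I = {S. processes_jobs m I S \<and> mode_ok M (fst I) S}"

text \<open>
  The load of a machine is its last finishing time, so idle time before it counts; the inserted
  \<open>0\<close> is the load of a machine without pieces.
\<close>

definition load :: "piece set \<Rightarrow> nat \<Rightarrow> real" where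
  "load S i = Max (insert 0 (finish ` {x \<in> S. mach x = i}))"

definition loads :: "nat \<Rightarrow> piece set \<Rightarrow> real list" where
  "loads m S = map (load S) [0..<m]"

definition sched_ratio :: "preemption_mode \<Rightarrow> nat \<Rightarrow> inst \<Rightarrow> piece set \<Rightarrow> ereal" where
  "sched_ratio M m I S =
     Inf (ereal ` {\<alpha>. \<forall>T\<in>schedules M m I. loads m S \<preceq>\<^sub>s map ((*) \<alpha>) (loads m T)})"

definition inst_ratio :: "preemption_mode \<Rightarrow> nat \<Rightarrow> inst \<Rightarrow> ereal" where
  "inst_ratio M m I = (INF S\<in>schedules M m I. sched_ratio M m I S)"

definition WAR :: "environment \<Rightarrow> preemption_mode \<Rightarrow> nat \<Rightarrow> ereal" where
  "WAR E M m = (SUP I\<in>instances E m. inst_ratio M m I)"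

end

theory Submission
  imports Defs "HOL-Library.Multiset"
begin

text \<open>
  Upper bound: for a fixed instance let \<open>opt k\<close> be the infimum of the sums of the \<open>k\<close> largest loads,
  and let \<open>q\<close> be the integer part of \<open>\<surd>m\<close>. A sum of the \<open>k\<close> largest entries grows with \<open>k\<close>, at most
  linearly. If \<open>opt (q + 1) \<le> \<surd>m opt 1\<close>, then a schedule that is nearly optimal for \<open>k = q + 1\<close> is
  within \<open>\<surd>m\<close> (up to a factor close to \<open>1\<close>) of \<open>opt k\<close> for all \<open>k\<close>; otherwise a schedule that is
  nearly optimal for \<open>k = q\<close> is.

  Lower bound: take one machine of speed \<open>s = \<surd>m + 1\<close>, \<open>m - 1\<close> machines of speed \<open>1\<close>, and \<open>m\<close> jobs
  with sizes equal to the speeds. Giving each machine its own job makes all loads \<open>1\<close>; putting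
  everything on the fast machine makes the total load \<open>(s + m - 1) / s\<close>. A schedule
  that is \<open>\<alpha>\<close>-competitive with both leaves too little room for the total work unless
  \<open>\<alpha> \<ge> s (s + m - 1) / (s\<^sup>2 + m - 1) = (\<surd>m + 1) / 2\<close>; \<open>s\<close> maximises this quotient.
\<close>

section \<open>Sums of the largest entries\<close>

definition top_sum :: "real list \<Rightarrow> nat \<Rightarrow> real" where
  "top_sum xs k = sum_list (take k (sort_desc xs))"

lemma length_sort_desc [simp]: "length (sort_desc xs) = length xs"
  by (simp add: sort_desc_def)

lemma set_sort_desc [simp]: "set (sort_desc xs) = set xs"
  by (simp add: sort_desc_def)

lemma sum_list_sort_desc [simp]: "sum_list (sort_desc xs) = sum_list xs"
proof -
  have "mset (sort_desc xs) = mset xs"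
    by (simp add: sort_desc_def)
  then show ?thesis
    by (metis sum_mset_sum_list)
qed

lemma sort_desc_nth_antimono:
  assumes "i \<le> j" "j < length xs"
  shows "sort_desc xs ! j \<le> sort_desc xs ! i"
  using assms unfolding sort_desc_def
  by (auto simp: rev_nth intro!: sorted_nth_mono)

text \<open>Reduces majorisation to one scalar inequality per \<open>k\<close>, the form in which
  everything below uses it. Position \<open>k\<close> of \<open>prefix_sums\<close> holds the sum of
  \<open>Suc k\<close> entries, so the range starts at 1.\<close>

lemma weak_maj_iff:
  assumes "length xs = length ys"
  shows "xs \<preceq>\<^sub>s ys \<longleftrightarrow> (\<forall>k\<in>{1..length xs}. top_sum xs k \<le> top_sum ys k)"
proof -
  have "xs \<preceq>\<^sub>s ys \<longleftrightarrow> (\<forall>k<length xs. top_sum xs (Suc k) \<le> top_sum ys (Suc k))"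
    using assms by (auto simp: weak_maj_def prefix_sums_def list_all2_conv_all_nth top_sum_def)
  also have "\<dots> \<longleftrightarrow> (\<forall>k\<in>{1..length xs}. top_sum xs k \<le> top_sum ys k)"
    unfolding image_Suc_lessThan[symmetric] by auto
  finally show ?thesis .
qed

lemma sort_desc_map_mult:
  assumes "0 \<le> a"
  shows "sort_desc (map ((*) a) xs) = map ((*) a) (sort_desc xs)"
proof -
  have "sorted (map ((*) a) (sort xs))"
    using assms by (auto simp: sorted_map intro: sorted_wrt_mono_rel[OF _ sorted_sort] mult_left_mono)
  then have "sort (map ((*) a) xs) = map ((*) a) (sort xs)"
    by (intro properties_for_sort) auto
  then show ?thesis
    by (simp add: sort_desc_def rev_map)
qed

lemma top_sum_map_mult:
  assumes "0 \<le> a"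
  shows "top_sum (map ((*) a) xs) k = a * top_sum xs k"
  using assms by (simp add: top_sum_def sort_desc_map_mult take_map sum_list_const_mult)

lemma top_sum_length [simp]: "top_sum xs (length xs) = sum_list xs"
  by (simp add: top_sum_def)

lemma top_sum_conv_sum:
  assumes "k \<le> length xs"
  shows "top_sum xs k = (\<Sum>i<k. sort_desc xs ! i)"
  using assms by (simp add: top_sum_def sum_list_sum_nth atLeast0LessThan)

lemma le_top_sum_1:
  assumes "x \<in> set xs"
  shows "x \<le> top_sum xs 1"
proof -
  from assms obtain i where i: "i < length xs" "sort_desc xs ! i = x"
    by (metis in_set_conv_nth length_sort_desc set_sort_desc)
  moreover have "top_sum xs 1 = sort_desc xs ! 0"
    using i by (subst top_sum_conv_sum) auto
  ultimately show ?thesis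
    using sort_desc_nth_antimono[of 0 i xs] by simp
qed

lemma top_sum_beyond:
  assumes "length xs \<le> k"
  shows "top_sum xs k = top_sum xs (length xs)"
  using assms by (simp add: top_sum_def)

lemma top_sum_mono:
  assumes "\<And>x. x \<in> set xs \<Longrightarrow> 0 \<le> x" "j \<le> k"
  shows "top_sum xs j \<le> top_sum xs k"
proof -
  have "take k (sort_desc xs) = take j (sort_desc xs) @ take (k - j) (drop j (sort_desc xs))"
    using take_add[of j "k - j" "sort_desc xs"] assms(2) by simp
  moreover have "0 \<le> sum_list (take (k - j) (drop j (sort_desc xs)))"
    using assms(1) by (intro sum_list_nonneg) (auto dest!: in_set_takeD in_set_dropD)
  ultimately show ?thesis
    by (simp add: top_sum_def)
qed

text \<open>The mean of the \<open>k\<close> largest entries cannot grow with \<open>k\<close>,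
  since each new entry is at most each of the first \<open>j\<close>. Past the end of the list the
  sum stays constant.\<close>

lemma top_sum_scale:
  assumes nonneg: "\<And>x. x \<in> set xs \<Longrightarrow> 0 \<le> x" and "j \<le> k"
  shows "real j * top_sum xs k \<le> real k * top_sum xs j"
  using \<open>j \<le> k\<close>
proof (induction k rule: dec_induct)
  case (step k)
  show ?case
  proof (cases "k < length xs")
    case True
    let ?x = "sort_desc xs ! k"
    have "(\<Sum>i<j. ?x) \<le> (\<Sum>i<j. sort_desc xs ! i)"
      using step.hyps True by (intro sum_mono sort_desc_nth_antimono) auto
    then have "real j * ?x \<le> top_sum xs j"
      using step.hyps True by (simp add: top_sum_conv_sum)
    moreover have "top_sum xs (Suc k) = top_sum xs k + ?x"
      using True by (simp add: top_sum_conv_sum)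
    ultimately show ?thesis
      using step.IH by (simp add: algebra_simps)
  next
    case False
    then have "top_sum xs (Suc k) = top_sum xs k"
      using top_sum_beyond[of xs k] top_sum_beyond[of xs "Suc k"] by simp
    moreover have "0 \<le> top_sum xs j"
      using top_sum_mono[of xs 0 j, OF nonneg] by (simp add: top_sum_def)
    ultimately show ?thesis
      using step.IH by (simp add: algebra_simps)
  qed
qed simp

section \<open>Simultaneous approximation\<close>

text \<open>Isolates the two properties of top sums that matter, \<open>mono\<close> and
  \<open>scale\<close>. They are not restricted to \<open>k\<close> up to \<open>m\<close> because
  \<open>q + 1\<close> exceeds \<open>m\<close> when \<open>m\<close> is 1. The factor
  \<open>e\<close> is there because infima need not be attained.\<close>

lemma simultaneous_approximation:
  fixes f :: "'a \<Rightarrow> nat \<Rightarrow> real"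
  assumes "m \<ge> 1" "A \<noteq> {}" "c > 0"
    and lower: "\<And>x. x \<in> A \<Longrightarrow> c \<le> f x 1"
    and mono: "\<And>x j k. x \<in> A \<Longrightarrow> j \<le> k \<Longrightarrow> f x j \<le> f x k"
    and scale: "\<And>x j k. x \<in> A \<Longrightarrow> j \<le> k \<Longrightarrow> real j * f x k \<le> real k * f x j"
    and "e > 1"
  obtains x where "x \<in> A" "\<And>y k. y \<in> A \<Longrightarrow> k \<in> {1..m} \<Longrightarrow> f x k \<le> e * sqrt m * f y k"
proof -
  define opt where "opt k = (INF x\<in>A. f x k)" for k
  have bdd: "bdd_below ((\<lambda>x. f x k) ` A)" if "k \<ge> 1" for k
    using lower mono[OF _ that] by (intro bdd_belowI[of _ c]) force
  have opt_le: "opt k \<le> f x k" if "x \<in> A" "k \<ge> 1" for x k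
    unfolding opt_def using that by (intro cINF_lower bdd)
  have opt_ge: "b \<le> opt k" if "\<And>x. x \<in> A \<Longrightarrow> b \<le> f x k" for b k
    unfolding opt_def using \<open>A \<noteq> {}\<close> that by (intro cINF_greatest)
  have opt_1: "opt 1 > 0"
    using opt_ge[OF lower] \<open>c > 0\<close> by simp
  have opt_mono: "opt j \<le> opt k" if "1 \<le> j" "j \<le> k" for j k
    by (rule opt_ge) (meson mono opt_le order_trans that)
  have opt_lin: "opt k \<le> k * opt 1" if "k \<ge> 1" for k
  proof -
    have "opt k / k \<le> opt 1"
    proof (rule opt_ge)
      fix x assume "x \<in> A"
      then show "opt k / k \<le> f x 1"
        using opt_le[of x k] scale[of x 1 k] that by (simp add: field_simps)
    qed
    then show ?thesis
      using that by (simp add: field_simps)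
  qed
  \<comment> \<open>The uniform lower bound \<open>c\<close> makes \<open>opt k\<close> positive, so
    \<open>e * opt k\<close> lies strictly above the infimum.\<close>
  have near_opt: "\<exists>x\<in>A. f x k \<le> e * opt k" if "k \<ge> 1" for k
  proof (rule ccontr)
    assume "\<not> ?thesis"
    then have "e * opt k \<le> opt k"
      by (intro opt_ge) force
    moreover have "opt k > 0"
      using opt_1 opt_mono[of 1 k] that by linarith
    ultimately show False
      using \<open>e > 1\<close> by simp
  qed
  define q where "q = nat \<lfloor>sqrt m\<rfloor>"
  have q: "q \<ge> 1" "real q \<le> sqrt m" "sqrt m < real q + 1"
    using \<open>m \<ge> 1\<close> unfolding q_def by (simp_all add: le_nat_iff of_nat_floor)
  have "\<exists>x\<in>A. \<forall>k\<in>{1..m}. f x k \<le> e * (sqrt m * opt k)"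
  proof (cases "opt (q + 1) \<le> sqrt m * opt 1")
    case True
    obtain x where x: "x \<in> A" "f x (q + 1) \<le> e * opt (q + 1)"
      using near_opt[of "q + 1"] by auto
    have "f x k \<le> e * (sqrt m * opt k)" if "k \<in> {1..m}" for k
    proof (cases "k \<le> q + 1")
      case le: True
      have "f x k \<le> e * opt (q + 1)"
        using mono[OF x(1) le] x(2) by linarith
      also have "opt (q + 1) \<le> sqrt m * opt k"
        using True opt_mono[of 1 k] that
        by (meson atLeastAtMost_iff mult_left_mono order_refl order_trans real_sqrt_ge_zero of_nat_0_le_iff)
      finally show ?thesis
        using \<open>e > 1\<close> by simp
    next
      case False
      \<comment> \<open>The loss is at most \<open>k / (q + 1)\<close>, which is below
        \<open>sqrt m\<close> because \<open>k\<close> is at most \<open>m\<close> and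
        \<open>sqrt m < q + 1\<close>.\<close>
      have "real (q + 1) * f x k \<le> real k * f x (q + 1)"
        using scale[OF x(1), of "q + 1" k] False by simp
      also have "\<dots> \<le> real m * (e * opt k)"
      proof (rule mult_mono)
        show "f x (q + 1) \<le> e * opt k"
          using x(2) opt_mono[of "q + 1" k] False \<open>e > 1\<close>
          by (smt (verit) le_add2 linorder_le_cases mult_left_mono)
        show "0 \<le> f x (q + 1)"
          using lower[OF x(1)] mono[OF x(1), of 1 "q + 1"] \<open>c > 0\<close> by simp
      qed (use that in auto)
      also have "\<dots> = sqrt m * (e * (sqrt m * opt k))"
        by simp
      also have "\<dots> \<le> real (q + 1) * (e * (sqrt m * opt k))"
        using q opt_1 opt_mono[of 1 k] that \<open>e > 1\<close> by (intro mult_right_mono) auto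
      finally show ?thesis
        by (rule mult_left_le_imp_le) simp
    qed
    with x show ?thesis by blast
  next
    case False
    obtain x where x: "x \<in> A" "f x q \<le> e * opt q"
      using near_opt[of q] q by auto
    have "f x k \<le> e * (sqrt m * opt k)" if "k \<in> {1..m}" for k
    proof (cases "k \<le> q")
      case True
      have "f x k \<le> e * opt q"
        using mono[OF x(1) True] x(2) by linarith
      also have "opt q \<le> q * opt 1"
        using opt_lin q by simp
      also have "\<dots> \<le> sqrt m * opt k"
        using q opt_1 opt_mono[of 1 k] that by (intro mult_mono) auto
      finally show ?thesis
        using \<open>e > 1\<close> by simp
    next
      case gt: False
      \<comment> \<open>The factor \<open>q\<close> lost in \<open>opt_lin\<close> cancels against
        the mean comparison, leaving \<open>e * k * opt 1\<close>. The failed case condition then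
        trades \<open>sqrt m * opt 1\<close> for \<open>opt (q + 1)\<close>.\<close>
      have "real q * f x k \<le> real k * f x q"
        using scale[OF x(1), of q k] gt by simp
      also have "\<dots> \<le> real k * (e * (q * opt 1))"
      proof (rule mult_left_mono)
        show "f x q \<le> e * (q * opt 1)"
          using x(2) opt_lin[of q] q \<open>e > 1\<close> by (smt (verit) mult_left_mono)
      qed simp
      finally have "real q * f x k \<le> real q * (e * (k * opt 1))"
        by (simp add: mult_ac)
      then have "f x k \<le> e * (k * opt 1)"
        using q by simp
      also have "real k * opt 1 \<le> real m * opt 1"
        using that opt_1 by simp
      also have "\<dots> = sqrt m * (sqrt m * opt 1)"
        by simp
      also have "\<dots> \<le> sqrt m * opt k"
        using False gt opt_mono[of "q + 1" k] by (intro mult_left_mono) auto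
      finally show ?thesis
        using \<open>e > 1\<close> by simp
    qed
    with x show ?thesis by blast
  qed
  then obtain x where x: "x \<in> A" "\<And>k. k \<in> {1..m} \<Longrightarrow> f x k \<le> e * (sqrt m * opt k)"
    by blast
  have "f x k \<le> e * sqrt m * f y k" if "y \<in> A" "k \<in> {1..m}" for y k
  proof -
    have "e * (sqrt m * opt k) \<le> e * (sqrt m * f y k)"
      using opt_le[of y k] that \<open>e > 1\<close> by (intro mult_left_mono) auto
    then show ?thesis
      using x(2)[OF that(2)] by (simp add: algebra_simps)
  qed
  then show ?thesis
    using that x(1) by blast
qed

section \<open>Loads of schedules\<close>

lemma length_loads [simp]: "length (loads m S) = m"
  by (simp add: loads_def)

lemma load_nonneg:
  assumes "finite S"
  shows "0 \<le> load S i"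
  using assms by (simp add: load_def)

lemma finish_le_load:
  assumes "finite S" "x \<in> S"
  shows "finish x \<le> load S (mach x)"
  using assms by (auto simp: load_def intro!: Max_ge)

lemma sum_list_loads: "sum_list (loads m S) = (\<Sum>i<m. load S i)"
  by (simp add: loads_def interv_sum_list_conv_sum_set_nat atLeast0LessThan)

text \<open>Add the pieces in order of finishing time: all earlier ones end before the new one
  starts, so the induction hypothesis applies with \<open>start x\<close> in place of
  \<open>L\<close>.\<close>

lemma sum_disjoint_intervals_le:
  assumes "finite A"
    and "\<And>x. x \<in> A \<Longrightarrow> 0 \<le> start x \<and> start x < finish x \<and> finish x \<le> L"
    and "\<And>x y. x \<in> A \<Longrightarrow> y \<in> A \<Longrightarrow> x \<noteq> y \<Longrightarrow> interval x \<inter> interval y = {}"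
    and "0 \<le> L"
  shows "(\<Sum>x\<in>A. finish x - start x) \<le> L"
  using assms
proof (induction A arbitrary: L rule: finite_ranking_induct[where f = finish])
  case empty
  then show ?case by simp
next
  case (insert x A)
  have x: "0 \<le> start x" "start x < finish x" "finish x \<le> L"
    using insert.prems(1) by auto
  have "finish y \<le> start x" if "y \<in> A" "y \<noteq> x" for y
  proof (rule ccontr)
    assume "\<not> finish y \<le> start x"
    \<comment> \<open>The later of the two starts is a common point, as \<open>x\<close> finishes
      last.\<close>
    then have "max (start x) (start y) \<in> interval x \<inter> interval y"
      using insert.hyps(2)[OF that(1)] insert.prems(1)[of y] x that by (auto simp: interval_def)
    then show False
      using insert.prems(2)[of x y] that by auto
  qed
  then have rest: "x \<notin> A \<Longrightarrow> (\<Sum>y\<in>A. finish y - start y) \<le> start x"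
    using insert.prems x(1) by (intro insert.IH) auto
  show ?case
  \<comment> \<open>The ranking induction does not guarantee that the inserted element is
    new.\<close>
  proof (cases "x \<in> A")
    case True
    then show ?thesis
      using insert.prems insert.IH[of L] by (simp add: insert_absorb)
  next
    case False
    then show ?thesis
      using rest x(3) insert.hyps(1) by simp
  qed
qed

text \<open>Group the pieces by machine; on each one they are disjoint and end by its load. Weights
  1/\<open>t i 0\<close> measure the completed fraction of job 0, and speeds as weights measure the
  total work.\<close>

lemma weighted_work_le_loads:
  assumes S: "processes_jobs m (n, t) S" and "A \<subseteq> S" and c: "\<And>i. i < m \<Longrightarrow> 0 \<le> c i"
  shows "(\<Sum>x\<in>A. (finish x - start x) * c (mach x)) \<le> (\<Sum>i<m. c i * load S i)"
proof -
  have fin: "finite S" "finite A"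
    using S \<open>A \<subseteq> S\<close> by (auto simp: processes_jobs_def intro: finite_subset)
  have disj: "interval x \<inter> interval y = {}" if "x \<in> S" "y \<in> S" "x \<noteq> y" "mach x = mach y" for x y
    using S that by (simp add: processes_jobs_def)
  have "(\<Sum>x\<in>A. (finish x - start x) * c (mach x)) =
      (\<Sum>i<m. \<Sum>x\<in>{x \<in> A. mach x = i}. (finish x - start x) * c (mach x))"
    using S \<open>A \<subseteq> S\<close> fin by (intro sum.group[symmetric]) (auto simp: processes_jobs_def)
  also have "\<dots> = (\<Sum>i<m. c i * (\<Sum>x\<in>{x \<in> A. mach x = i}. finish x - start x))"
    by (simp add: sum_distrib_left mult.commute)
  also have "\<dots> \<le> (\<Sum>i<m. c i * load S i)"
  proof (intro sum_mono mult_left_mono sum_disjoint_intervals_le)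
    fix i x assume "x \<in> {x \<in> A. mach x = i}"
    then show "0 \<le> start x \<and> start x < finish x \<and> finish x \<le> load S i"
      using S \<open>A \<subseteq> S\<close> finish_le_load[OF fin(1)] by (auto simp: processes_jobs_def)
  next
    fix i x y assume "x \<in> {x \<in> A. mach x = i}" "y \<in> {x \<in> A. mach x = i}" "x \<noteq> y"
    then show "interval x \<inter> interval y = {}"
      using disj[of x y] \<open>A \<subseteq> S\<close> by auto
  qed (use fin c load_nonneg in auto)
  finally show ?thesis .
qed

section \<open>Nonpreemptive schedules as witnesses in all three modes\<close>

lemma mode_ok_if_NP:
  assumes "mode_ok NP n S" "\<And>x. x \<in> S \<Longrightarrow> job x < n"
  shows "mode_ok M n S"
proof (cases M)
  case PP
  have "x = y" if "x \<in> S" "y \<in> S" "job x = job y" for x y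
  proof -
    have "\<exists>!z. z \<in> S \<and> job z = job x"
      using assms(1) assms(2)[OF that(1)] by simp
    then show ?thesis
      using that by auto
  qed
  with PP show ?thesis
    by auto
qed (use assms in auto)

text \<open>Job \<open>j\<close> runs on machine \<open>r j\<close> from time \<open>b j\<close>,
  and jobs sharing a machine run in index order. With one piece per job, every mode condition holds,
  so one construction serves all \<open>M\<close>.\<close>

lemma nonpreemptive_schedule:
  assumes "\<And>j. j < n \<Longrightarrow> r j < m \<and> 0 < t (r j) j \<and> 0 \<le> b j"
    and "\<And>j k. j < k \<Longrightarrow> k < n \<Longrightarrow> r j = r k \<Longrightarrow> b j + t (r j) j \<le> b k"
  shows "(\<lambda>j. Piece (r j) j (b j) (b j + t (r j) j)) ` {..<n} \<in> schedules M m (n, t)"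
    (is "?P ` _ \<in> _")
proof -
  have disj: "interval (?P j) \<inter> interval (?P k) = {}"
    if "j < n" "k < n" "j \<noteq> k" "r j = r k" for j k
    using that assms(2)[of j k] assms(2)[of k j]
    by (cases "j < k") (auto simp: interval_def)
  have only: "{x \<in> ?P ` {..<n}. job x = j} = {?P j}" if "j < n" for j
    using that by auto
  have "(\<Sum>x\<in>{x \<in> ?P ` {..<n}. job x = j}. (finish x - start x) / t (mach x) j) = 1" if "j < n" for j
    unfolding only[OF that] using assms(1)[OF that] by simp
  then have "processes_jobs m (n, t) (?P ` {..<n})"
    using assms(1) disj unfolding processes_jobs_def by (auto simp del: disjoint_iff) blast+
  moreover have "mode_ok NP n (?P ` {..<n})"
    by auto
  then have "mode_ok M n (?P ` {..<n})"
    by (rule mode_ok_if_NP) auto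
  ultimately show ?thesis
    by (simp add: schedules_def)
qed

text \<open>Runs all jobs back to back on machine 0. It shows that schedules exist and later
  supplies the competitor with small total load.\<close>

lemma single_machine_schedule:
  assumes "m \<ge> 1" "\<And>j. j < n \<Longrightarrow> 0 < t 0 j"
  obtains S where "S \<in> schedules M m (n, t)" "(\<Sum>i<m. load S i) \<le> (\<Sum>j<n. t 0 j)"
proof -
  define b where "b j = (\<Sum>k<j. t 0 k)" for j
  define S where "S = (\<lambda>j. Piece 0 j (b j) (b j + t 0 j)) ` {..<n}"
  have b_mono: "b j \<le> b k" if "j \<le> k" "k \<le> n" for j k
    unfolding b_def using that assms(2) by (intro sum_mono2) (auto intro: less_imp_le)
  have b_Suc: "b j + t 0 j = b (Suc j)" for j
    by (simp add: b_def)
  have "S \<in> schedules M m (n, t)"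
    unfolding S_def
  proof (rule nonpreemptive_schedule[where r = "\<lambda>_. 0"])
    show "0 < m \<and> 0 < t 0 j \<and> 0 \<le> b j" if "j < n" for j
      using assms that b_mono[of 0 j] by (auto simp: b_def)
    show "b j + t 0 j \<le> b k" if "j < k" "k < n" for j k
      using b_mono[of "Suc j" k] that by (simp add: b_Suc)
  qed
  moreover have "load S 0 \<le> b n"
    using b_mono[of 0 n] b_mono by (auto simp: load_def S_def b_Suc b_def[of 0])
  moreover have "load S i = 0" if "i \<noteq> 0" for i
  proof -
    have no_pieces: "{x \<in> S. mach x = i} = {}"
      using that by (auto simp: S_def)
    show ?thesis
      unfolding load_def no_pieces by simp
  qed
  then have "(\<Sum>i<m. load S i) = load S 0"
    using \<open>m \<ge> 1\<close> by (subst sum.remove[of _ 0]) auto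
  ultimately show ?thesis
    using that by (simp add: b_def)
qed

section \<open>The upper bound\<close>

lemma inst_ratio_le_sqrt:
  assumes "m \<ge> 1" "n \<ge> 1" and pos: "\<And>i j. i < m \<Longrightarrow> j < n \<Longrightarrow> 0 < t i j"
  shows "inst_ratio M m (n, t) \<le> ereal (sqrt m)"
proof (rule ereal_le_epsilon2)
  fix d :: real assume "d > 0"
  let ?\<S> = "schedules M m (n, t)"
  \<comment> \<open>Chosen so that \<open>e * sqrt m\<close> is exactly
    \<open>sqrt m + d\<close>.\<close>
  define e where "e = 1 + d / sqrt m"
  have e: "e > 1" "e * sqrt m = sqrt m + d"
    using \<open>m \<ge> 1\<close> \<open>d > 0\<close> by (auto simp: e_def field_simps)
  have nonneg: "0 \<le> l" if "S \<in> ?\<S>" "l \<in> set (loads m S)" for S l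
    using that load_nonneg by (auto simp: schedules_def processes_jobs_def loads_def)
  \<comment> \<open>The combined rate of all machines on job 0: even perfect sharing needs time
    \<open>1 / c\<close>, a positive lower bound on the largest load of every schedule.\<close>
  define c where "c = (\<Sum>i<m. 1 / t i 0)"
  have "c > 0"
    unfolding c_def using assms by (intro sum_pos) (auto simp: lessThan_empty_iff)
  have lower: "1 / c \<le> top_sum (loads m S) 1" if "S \<in> ?\<S>" for S
  proof -
    have S: "processes_jobs m (n, t) S"
      using that by (simp add: schedules_def)
    have "1 = (\<Sum>x\<in>{x \<in> S. job x = 0}. (finish x - start x) * (1 / t (mach x) 0))"
      using S \<open>n \<ge> 1\<close> by (auto simp: processes_jobs_def)
    also have "\<dots> \<le> (\<Sum>i<m. 1 / t i 0 * load S i)"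
      using pos \<open>n \<ge> 1\<close> by (intro weighted_work_le_loads[OF S]) (auto intro: less_imp_le)
    also have "\<dots> \<le> (\<Sum>i<m. 1 / t i 0 * top_sum (loads m S) 1)"
      using pos \<open>n \<ge> 1\<close>
      by (intro sum_mono mult_left_mono le_top_sum_1) (auto simp: loads_def intro: less_imp_le)
    also have "\<dots> = c * top_sum (loads m S) 1"
      by (simp add: c_def sum_distrib_right)
    finally show ?thesis
      using \<open>c > 0\<close> by (simp add: field_simps)
  qed
  have nonempty: "?\<S> \<noteq> {}"
    using single_machine_schedule[of m n t M] assms by force
  obtain S where S: "S \<in> ?\<S>"
    "\<And>T k. T \<in> ?\<S> \<Longrightarrow> k \<in> {1..m} \<Longrightarrow>
       top_sum (loads m S) k \<le> e * sqrt m * top_sum (loads m T) k"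
  proof (rule simultaneous_approximation[of m ?\<S> "1 / c" "\<lambda>S. top_sum (loads m S)" e])
    show "top_sum (loads m S) j \<le> top_sum (loads m S) k" if "S \<in> ?\<S>" "j \<le> k" for S j k
      using top_sum_mono[of "loads m S" j k] nonneg that by simp
    show "real j * top_sum (loads m S) k \<le> real k * top_sum (loads m S) j"
      if "S \<in> ?\<S>" "j \<le> k" for S j k
      using top_sum_scale[of "loads m S" j k] nonneg that by simp
  qed (use \<open>m \<ge> 1\<close> \<open>c > 0\<close> nonempty lower e(1) in auto)
  have "loads m S \<preceq>\<^sub>s map ((*) (e * sqrt m)) (loads m T)" if "T \<in> ?\<S>" for T
    using S(2)[OF that] e(1) by (simp add: weak_maj_iff top_sum_map_mult)
  then have "sched_ratio M m (n, t) S \<le> ereal (e * sqrt m)"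
    unfolding sched_ratio_def by (intro Inf_lower) auto
  then show "inst_ratio M m (n, t) \<le> ereal (sqrt m) + ereal d"
    unfolding inst_ratio_def using S(1) e(2) by (auto intro: INF_lower2)
qed

text \<open>Lets one related instance give the lower bound in both environments.\<close>

lemma instances_Related_subset: "instances Related m \<subseteq> instances E m"
  by (cases E) auto

section \<open>The lower bound\<close>

lemma inst_ratio_ge:
  assumes "m \<ge> 1"
  defines "v \<equiv> \<lambda>i. if i = 0 then sqrt m + 1 else (1::real)"
  shows "ereal ((sqrt m + 1) / 2) \<le> inst_ratio M m (m, \<lambda>i j. v j / v i)"
  unfolding inst_ratio_def sched_ratio_def
proof (rule INF_greatest, rule Inf_greatest)
  fix S and a :: ereal
  let ?\<S> = "schedules M m (m, \<lambda>i j. v j / v i)"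
  assume S: "S \<in> ?\<S>" and "a \<in> ereal ` {\<alpha>. \<forall>T\<in>?\<S>. loads m S \<preceq>\<^sub>s map ((*) \<alpha>) (loads m T)}"
  then obtain \<alpha> where a: "a = ereal \<alpha>"
    and maj: "\<And>T k. T \<in> ?\<S> \<Longrightarrow> k \<in> {1..m} \<Longrightarrow>
      top_sum (loads m S) k \<le> top_sum (map ((*) \<alpha>) (loads m T)) k"
    by (auto simp: weak_maj_iff)
  define s where "s = sqrt m + 1"
  define W where "W = s + real m - 1"
  have "s > 1" and v_pos: "v i > 0" for i
    using \<open>m \<ge> 1\<close> by (auto simp: s_def v_def add_nonneg_pos)
  have split: "(\<Sum>i<m. g i) = g 0 + (\<Sum>i\<in>{1..<m}. g i)" for g :: "nat \<Rightarrow> real"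
    using \<open>m \<ge> 1\<close> by (simp add: lessThan_atLeast0 sum.atLeast_Suc_lessThan)
  have W: "(\<Sum>j<m. v j) = W"
    unfolding split using \<open>m \<ge> 1\<close> by (simp add: v_def W_def s_def of_nat_diff)
  have S_proc: "processes_jobs m (m, \<lambda>i j. v j / v i) S"
    using S by (simp add: schedules_def)
  then have "finite S"
    by (simp add: processes_jobs_def)

  define T where "T = (\<lambda>j. Piece j j 0 (0 + v j / v j)) ` {..<m}"
  have "T \<in> ?\<S>"
    unfolding T_def using v_pos by (intro nonpreemptive_schedule[where r = "\<lambda>j. j"]) (auto simp: less_imp_neq[symmetric])
  moreover have "load T i = 1" if "i < m" for i
  proof -
    have own_piece: "{x \<in> T. mach x = i} = {Piece i i 0 1}"
      using that v_pos[of i] by (auto simp: T_def image_iff)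
    show ?thesis
      unfolding load_def own_piece by simp
  qed
  \<comment> \<open>The sign of \<alpha> is still unknown, so \<open>top_sum_map_mult\<close> does
    not apply; the scaled vector is computed directly.\<close>
  then have "map ((*) \<alpha>) (loads m T) = replicate m \<alpha>"
    by (intro nth_equalityI) (auto simp: loads_def)
  then have "top_sum (map ((*) \<alpha>) (loads m T)) 1 = \<alpha>"
    using \<open>m \<ge> 1\<close> set_sort_desc[of "replicate m \<alpha>"] length_sort_desc[of "replicate m \<alpha>"]
    by (cases "sort_desc (replicate m \<alpha>)") (auto simp: top_sum_def split: if_splits)
  ultimately have "top_sum (loads m S) 1 \<le> \<alpha>"
    using maj[of T 1] \<open>m \<ge> 1\<close> by simp
  moreover have "load S 0 \<le> top_sum (loads m S) 1"
    using \<open>m \<ge> 1\<close> by (intro le_top_sum_1) (auto simp: loads_def)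
  ultimately have fast: "load S 0 \<le> \<alpha>"
    by linarith
  then have "\<alpha> \<ge> 0"
    using load_nonneg[OF \<open>finite S\<close>, of 0] by linarith

  obtain U where U: "U \<in> ?\<S>" "(\<Sum>i<m. load U i) \<le> (\<Sum>j<m. v j / v 0)"
    using single_machine_schedule[of m m "\<lambda>i j. v j / v i" M] \<open>m \<ge> 1\<close> v_pos by auto
  \<comment> \<open>At \<open>k = m\<close> majorisation compares total loads.\<close>
  have "(\<Sum>i<m. load S i) \<le> \<alpha> * (\<Sum>i<m. load U i)"
    using maj[OF U(1), of m] \<open>m \<ge> 1\<close> \<open>\<alpha> \<ge> 0\<close> top_sum_length[of "loads m S"] top_sum_length[of "loads m U"]
    by (simp add: top_sum_map_mult sum_list_loads)
  also have "\<dots> \<le> \<alpha> * (W / s)"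
    using U(2) \<open>\<alpha> \<ge> 0\<close> W by (intro mult_left_mono) (simp_all add: sum_divide_distrib[symmetric] v_def s_def)
  finally have total: "(\<Sum>i<m. load S i) \<le> \<alpha> * (W / s)" .

  \<comment> \<open>Time weighted by machine speed is work, and the work on job \<open>j\<close>
    adds up to its size \<open>v j\<close>.\<close>
  have "W = (\<Sum>j<m. \<Sum>x\<in>{x \<in> S. job x = j}. (finish x - start x) * v (mach x))"
  proof -
    have "v j = (\<Sum>x\<in>{x \<in> S. job x = j}. (finish x - start x) * v (mach x))" if "j < m" for j
    proof -
      have "v j = v j * (\<Sum>x\<in>{x \<in> S. job x = j}. (finish x - start x) / (v j / v (mach x)))"
        using S_proc that by (simp add: processes_jobs_def)
      also have "\<dots> = (\<Sum>x\<in>{x \<in> S. job x = j}. (finish x - start x) * v (mach x))"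
        unfolding sum_distrib_left using v_pos[of j] by (intro sum.cong) auto
      finally show ?thesis .
    qed
    then show ?thesis
      unfolding W[symmetric] by (intro sum.cong) auto
  qed
  also have "\<dots> = (\<Sum>x\<in>S. (finish x - start x) * v (mach x))"
    using S_proc by (intro sum.group) (auto simp: processes_jobs_def)
  also have "\<dots> \<le> (\<Sum>i<m. v i * load S i)"
    using v_pos by (intro weighted_work_le_loads[OF S_proc]) (auto intro: less_imp_le)
  \<comment> \<open>Split off the excess speed \<open>s - 1\<close> of machine 0:
    \<open>fast\<close> bounds this part, \<open>total\<close> the remaining unit speeds.\<close>
  also have "\<dots> = (s - 1) * load S 0 + (\<Sum>i<m. load S i)"
    unfolding split by (simp add: v_def s_def algebra_simps)
  also have "\<dots> \<le> (s - 1) * \<alpha> + \<alpha> * (W / s)"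
    using fast total \<open>s > 1\<close> by (intro add_mono mult_left_mono) auto
  also have "\<dots> = \<alpha> * ((s - 1) + W / s)"
    by (simp add: algebra_simps)
  finally have "W \<le> \<alpha> * ((s - 1) + W / s)" .
  \<comment> \<open>This choice of \<open>s\<close> gives \<open>W = s * (s - 1)\<close>, so both
    summands in the bracket equal \<open>s - 1\<close>.\<close>
  moreover have "W = s / 2 * ((s - 1) + W / s)"
  proof -
    have "real m = (s - 1)\<^sup>2"
      by (simp add: s_def)
    then have "W = s * (s - 1)"
      by (simp add: W_def algebra_simps power2_eq_square)
    then show ?thesis
      using \<open>s > 1\<close> by simp
  qed
  moreover have "(s - 1) + W / s > 0"
    using \<open>s > 1\<close> by (intro add_pos_nonneg) (auto simp: W_def)
  ultimately have "s / 2 \<le> \<alpha>"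
    by (metis mult_le_cancel_right_pos)
  then show "ereal ((sqrt m + 1) / 2) \<le> a"
    by (simp add: a s_def)
qed

theorem theorem13:
  fixes m :: nat and E :: environment and M :: preemption_mode
  assumes "m \<ge> 1"
  shows "ereal ((sqrt (real m) + 1) / 2) \<le> WAR E M m \<and> WAR E M m \<le> ereal (sqrt (real m))"
proof
  let ?v = "\<lambda>i::nat. if i = 0 then sqrt m + 1 else (1::real)"
  have "?v i > 0" for i
    by (simp add: add_nonneg_pos)
  then have "(m, \<lambda>i j. ?v j / ?v i) \<in> instances Related m"
    using assms by fastforce
  then have "(m, \<lambda>i j. ?v j / ?v i) \<in> instances E m"
    using instances_Related_subset by blast
  then show "ereal ((sqrt m + 1) / 2) \<le> WAR E M m"
    unfolding WAR_def using inst_ratio_ge[OF assms] by (rule SUP_upper2)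
  have "inst_ratio M m I \<le> ereal (sqrt m)" if "I \<in> instances E m" for I
    using that assms by (cases E) (auto intro!: inst_ratio_le_sqrt)
  then show "WAR E M m \<le> ereal (sqrt m)"
    unfolding WAR_def by (rule SUP_least)
qed

end
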